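(* For every point $x$ of the network (located at a vertex in $V$ or along an edge in $E$) there is an endpoint $w\in EP$ such that $T(x)\subseteq T(w)$. Moreover, in the dedicated routes refueling station location problem there is always an optimal solution $X^*$ with $X^*\subseteq EP$.
   Context: **Network.** $G(V,E)$ is a finite simple connected undirected graph with $|V|=n$, $|E|=e$ and positive edge lengths. Each edge is regarded as a closed segment of that length joining its two vertices; a *point* of the network is a vertex or a location along an edge. For points $x_1,x_2$, $l(x_1,x_2)$ is the length of a shortest path $P(x_1,x_2)$ between them (symmetric). Triangle inequality assumption: the shortest path between two points of the same edge runs inside that edge; in particular $l(v_a,v_b)$ is the length of edge $(v_a,v_b)$. $C(v_a,v_b)$ is the closed segment formed by edge $(v_a,v_b)$. $R>0$ is the driving range and $D\ge 0$ the maximum allowed deviation distance. **Routes.** $H=\{U_1,\dots,U_h\}$, $h\ge 1$, is the set of routes to be covered. Each $U\in H$ is a directed closed walk consisting of a finite nonempty sequence of edges (edges may repeat, in either direction), with total length $l(U)\le R$ and flow $f(U)>0$; it carries a finite nonempty cyclic sequence $S_U$ of stops, each a position on the walk. We write $(v_a,v_b)\in U$ if the edge is traversed by $U$ in some direction. $U(y,z)$ is the part of $U$ from position $y$ to position $z$ in the travel direction, $l(U(y,z))$ its length, and $V(U(y,z))$ the set of vertices on it. For a stop $s$: $s^f_U(s)$ is the next stop after $s$; $v^a_U(s)$ is the vertex coinciding with or immediately after $s$ on $U$; $v^b_U(s)$ is the vertex coinciding with or immediately before $s$ on $U$. **Last stop and deviation vertex.** For a point $x$, $s^l_U(x)$ is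 a stop $s\in S_U$ minimizing $$l(s,v^a_U(s))+l(v^a_U(s),x)+l(x,v^b_U(s^f_U(s)))+l(v^b_U(s^f_U(s)),s^f_U(s))+l(U(s^f_U(s),s)),$$ ties broken arbitrarily. Write $\bar v_U(x)=v^b_U(s^f_U(s^l_U(x)))$. The deviation vertex $v^d_U(x)$ is the vertex at which the path $P(v^a_U(s^l_U(x)),x)$ leaves the vertex set of the sub-route $U(v^a_U(s^l_U(x)),\bar v_U(x))$, i.e. the last vertex of the maximal initial run of vertices of that path lying in this set. Put $l'(U(\bar v_U(x),v^d_U(x)))=l(U)$ if $\bar v_U(x)=v^d_U(x)$, and $=l(U(\bar v_U(x),v^d_U(x)))$ otherwise. **Refueling sets.** Let $U\in H$ and $(v_a,v_b)\in E$. If $(v_a,v_b)\in U$, then $RS(U;v_a,v_b)=C(v_a,v_b)$. If $(v_a,v_b)\notin U$, then for $q\in\{a,b\}$ and $w\in\{a,b\}$, $w\ne q$, define $$\beta^{(q)}=\begin{cases} l(v_a,v_b), & \text{if } R-\big(l(v^d_U(v_q),v_q)+l(v_w,\bar v_U(v_q))+l'(U(\bar v_U(v_q),v^d_U(v_q)))\big)\ge l(v_a,v_b),\\ \tfrac12\Big(R-\big(l(v^d_U(v_q),v_q)+l(v_q,\bar v_U(v_q))+l'(U(\bar v_U(v_q),v^d_U(v_q)))\big)\Big), & \text{otherwise,}\end{cases}$$ $$\delta^{(q)}=\min\{D-l(v^d_U(v_q),v_q),\ \beta^{(q)}\},\qquad RS^{(q)}(U;v_a,v_b)=\{x\in C(v_a,v_b):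 l(v_q,x)\le\delta^{(q)}\},$$ and $RS(U;v_a,v_b)=RS^{(a)}(U;v_a,v_b)\cup RS^{(b)}(U;v_a,v_b)$. $RS(U;v_a,v_b)$ is the set of points of the edge $(v_a,v_b)$ that can cover route $U$. **Endpoints.** $EP(U;v_a,v_b)$ is the set of endpoints of the closed segments (connected components, possibly single points) making up $RS(U;v_a,v_b)$; $EP(v_a,v_b)=\bigcup_{U\in H}EP(U;v_a,v_b)$ and $EP=\bigcup_{(v_a,v_b)\in E}EP(v_a,v_b)$. **Coverage and problem.** For a point $x$, $T(x)=\{U\in H: x\in RS(U;v_a,v_b)\text{ for some }(v_a,v_b)\in E\}$ is the set of routes covered by $x$. The *dedicated routes refueling station location problem* asks for a set $X$ of points of the network of minimum cardinality such that $\bigcup_{x\in X}T(x)=H$. *)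

theory Defs
  imports "HOL-Analysis.Analysis"
begin

text \<open>
  The vertex set is a finite type \<open>'v\<close>. The network is realised geometrically in \<open>real ^ 'v\<close>: a vertex
  is a standard basis vector and an edge is the segment joining two basis vectors, so that every
  point of the network has exactly one representation. Edge lengths do not come from the
  Euclidean norm but are given separately.
\<close>

type_synonym 'v point = "real ^ 'v"

definition vertex :: "'v::finite \<Rightarrow> 'v point" where
  "vertex v = axis v 1"

definition edge_segment :: "'v::finite \<Rightarrow> 'v \<Rightarrow> 'v point set" where
  "edge_segment a b = closed_segment (vertex a) (vertex b)"

text \<open>
  A route is a closed walk, listed by its vertices with the first one repeated at the end. A position
  on it is the arc length \<open>\<sigma>\<close> travelled from the start, with \<open>0 \<le> \<sigma> < l(U)\<close>. This distinguishes different
  visits to the same point. Stops are positions.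
\<close>

record 'v route =
  walk :: "'v list"
  stops :: "real list"
  flow :: real

text \<open>
  The last three fields are the arbitrary choices of the model: the shortest path \<open>P(x, y)\<close>, the
  index in \<open>stops U\<close> of the stop minimising the cost of refuelling at \<open>x\<close>, and the place in
  \<open>walk U\<close> at which the deviation vertex is visited. They are constrained
  by \<open>admissible_choices\<close> below.
\<close>

record 'v problem =
  edges :: "'v set set"
  edge_length :: "'v set \<Rightarrow> real"
  driving_range :: real
  max_deviation :: real
  routes :: "'v route set"
  shortest_path :: "'v point \<Rightarrow> 'v point \<Rightarrow> 'v point list"
  last_stop :: "'v route \<Rightarrow> 'v point \<Rightarrow> nat"
  deviation_index :: "'v route \<Rightarrow> 'v point \<Rightarrow> nat"


subsection \<open>Network, paths and distances\<close>

definition is_network :: "'v::finite problem \<Rightarrow> bool" where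
  "is_network I \<longleftrightarrow>
     (\<forall>e\<in>edges I. card e = 2) \<and>
     (\<forall>e\<in>edges I. edge_length I e > 0) \<and>
     (\<forall>u v. (u, v) \<in> {(u, v). {u, v} \<in> edges I}\<^sup>*)"

definition points :: "'v::finite problem \<Rightarrow> 'v point set" where
  "points I = range vertex \<union> (\<Union>{edge_segment a b | a b. {a, b} \<in> edges I})"

definition on_common_edge :: "'v::finite problem \<Rightarrow> 'v point \<Rightarrow> 'v point \<Rightarrow> bool" where
  "on_common_edge I x y \<longleftrightarrow>
     (\<exists>a b. {a, b} \<in> edges I \<and> x \<in> edge_segment a b \<and> y \<in> edge_segment a b)"

text \<open>
  Length of the part of an edge between two of its points. The value is unique because two distinct
  points lie on at most one common edge, and \<open>\<bar>x $ a - y $ a\<bar> = \<bar>x $ b - y $ b\<bar>\<close> there.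
\<close>

definition step_length :: "'v::finite problem \<Rightarrow> 'v point \<Rightarrow> 'v point \<Rightarrow> real" where
  "step_length I x y =
     (THE r. \<exists>a b. {a, b} \<in> edges I \<and> x \<in> edge_segment a b \<and> y \<in> edge_segment a b \<and>
                   r = edge_length I {a, b} * \<bar>x $ a - y $ a\<bar>)"

text \<open>
  A path is a list of points, each consecutive two of which are joined inside an edge. The
  vertices it passes are therefore exactly the vertices occurring in the list.
\<close>

definition is_path :: "'v::finite problem \<Rightarrow> 'v point \<Rightarrow> 'v point \<Rightarrow> 'v point list \<Rightarrow> bool" where
  "is_path I x y ps \<longleftrightarrow>
     ps \<noteq> [] \<and> hd ps = x \<and> last ps = y \<and> set ps \<subseteq> points I \<and>
     successively (on_common_edge I) ps"

definition path_length :: "'v::finite problem \<Rightarrow> 'v point list \<Rightarrow> real" where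
  "path_length I ps = (\<Sum>i < length ps - 1. step_length I (ps ! i) (ps ! Suc i))"

definition is_shortest_path :: "'v::finite problem \<Rightarrow> 'v point \<Rightarrow> 'v point \<Rightarrow> 'v point list \<Rightarrow> bool" where
  "is_shortest_path I x y ps \<longleftrightarrow> is_arg_min (path_length I) (is_path I x y) ps"

definition net_dist :: "'v::finite problem \<Rightarrow> 'v point \<Rightarrow> 'v point \<Rightarrow> real" where
  "net_dist I x y = path_length I (shortest_path I x y)"

definition path_vertices :: "'v::finite point list \<Rightarrow> 'v list" where
  "path_vertices ps = map (inv vertex) (filter (\<lambda>p. p \<in> range vertex) ps)"


subsection \<open>Routes\<close>

abbreviation num_steps :: "'v route \<Rightarrow> nat" where
  "num_steps U \<equiv> length (walk U) - 1"

definition vertex_position :: "'v::finite problem \<Rightarrow> 'v route \<Rightarrow> nat \<Rightarrow> real" where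
  "vertex_position I U i = (\<Sum>j<i. edge_length I {walk U ! j, walk U ! Suc j})"

definition route_length :: "'v::finite problem \<Rightarrow> 'v route \<Rightarrow> real" where
  "route_length I U = vertex_position I U (num_steps U)"

definition route_edges :: "'v route \<Rightarrow> 'v set set" where
  "route_edges U = {{walk U ! i, walk U ! Suc i} | i. i < num_steps U}"

text \<open>The stops are listed in travel order, starting from any one of them.\<close>

definition is_route :: "'v::finite problem \<Rightarrow> 'v route \<Rightarrow> bool" where
  "is_route I U \<longleftrightarrow>
     length (walk U) \<ge> 2 \<and> hd (walk U) = last (walk U) \<and> route_edges U \<subseteq> edges I \<and>
     route_length I U \<le> driving_range I \<and> flow U > 0 \<and>
     stops U \<noteq> [] \<and> set (stops U) \<subseteq> {0..<route_length I U} \<and>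
     (\<exists>k. sorted_wrt (<) (rotate k (stops U)))"

text \<open>Travel length from position \<open>y\<close> to position \<open>z\<close>, which is \<open>0\<close> if \<open>y = z\<close>.\<close>

definition travel_length :: "'v::finite problem \<Rightarrow> 'v route \<Rightarrow> real \<Rightarrow> real \<Rightarrow> real" where
  "travel_length I U y z = (if y \<le> z then z - y else route_length I U - (y - z))"

text \<open>
  Vertices on a route are addressed by indices below \<open>num_steps U\<close>. A position after the last of these
  has the vertex at index \<open>0\<close> as the vertex following it.
\<close>

definition index_after :: "'v::finite problem \<Rightarrow> 'v route \<Rightarrow> real \<Rightarrow> nat" where
  "index_after I U \<sigma> = (LEAST i. \<sigma> \<le> vertex_position I U i) mod num_steps U"

definition index_before :: "'v::finite problem \<Rightarrow> 'v route \<Rightarrow> real \<Rightarrow> nat" where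
  "index_before I U \<sigma> = (GREATEST i. i < num_steps U \<and> vertex_position I U i \<le> \<sigma>)"

definition route_point :: "'v::finite problem \<Rightarrow> 'v route \<Rightarrow> real \<Rightarrow> 'v point" where
  "route_point I U \<sigma> =
     (let i = index_before I U \<sigma>; a = walk U ! i; b = walk U ! Suc i;
          t = (\<sigma> - vertex_position I U i) / edge_length I {a, b}
      in (1 - t) *\<^sub>R vertex a + t *\<^sub>R vertex b)"

definition subroute_indices :: "'v route \<Rightarrow> nat \<Rightarrow> nat \<Rightarrow> nat set" where
  "subroute_indices U i j = (if i \<le> j then {i..j} else {i..<num_steps U} \<union> {..j})"

definition next_stop :: "'v route \<Rightarrow> nat \<Rightarrow> nat" where
  "next_stop U j = Suc j mod length (stops U)"

definition stop_index_after :: "'v::finite problem \<Rightarrow> 'v route \<Rightarrow> nat \<Rightarrow> nat" where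
  "stop_index_after I U j = index_after I U (stops U ! j)"

definition stop_index_before :: "'v::finite problem \<Rightarrow> 'v route \<Rightarrow> nat \<Rightarrow> nat" where
  "stop_index_before I U j = index_before I U (stops U ! j)"


subsection \<open>Last stop and deviation vertex\<close>

definition refuel_cost :: "'v::finite problem \<Rightarrow> 'v route \<Rightarrow> 'v point \<Rightarrow> nat \<Rightarrow> real" where
  "refuel_cost I U x j =
     (let s = stops U ! j;
          s' = stops U ! next_stop U j;
          va = vertex (walk U ! stop_index_after I U j);
          vb = vertex (walk U ! stop_index_before I U (next_stop U j))
      in net_dist I (route_point I U s) va + net_dist I va x + net_dist I x vb
         + net_dist I vb (route_point I U s')
         + travel_length I U s' s)"

definition start_index :: "'v::finite problem \<Rightarrow> 'v route \<Rightarrow> 'v point \<Rightarrow> nat" where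
  "start_index I U x = stop_index_after I U (last_stop I U x)"

definition return_index :: "'v::finite problem \<Rightarrow> 'v route \<Rightarrow> 'v point \<Rightarrow> nat" where
  "return_index I U x = stop_index_before I U (next_stop U (last_stop I U x))"

definition return_vertex :: "'v::finite problem \<Rightarrow> 'v route \<Rightarrow> 'v point \<Rightarrow> 'v" where
  "return_vertex I U x = walk U ! return_index I U x"

definition deviation_vertex :: "'v::finite problem \<Rightarrow> 'v route \<Rightarrow> 'v point \<Rightarrow> 'v" where
  "deviation_vertex I U x =
     (let S = (!) (walk U) ` subroute_indices U (start_index I U x) (return_index I U x);
          p = shortest_path I (vertex (walk U ! start_index I U x)) x
      in last (takeWhile (\<lambda>v. v \<in> S) (path_vertices p)))"

text \<open>
  The second conjunct is the triangle inequality assumption: the shortest path between two points of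
  an edge runs inside that edge.
\<close>

definition admissible_choices :: "'v::finite problem \<Rightarrow> bool" where
  "admissible_choices I \<longleftrightarrow>
     (\<forall>x\<in>points I. \<forall>y\<in>points I. is_shortest_path I x y (shortest_path I x y)) \<and>
     (\<forall>a b. {a, b} \<in> edges I \<longrightarrow> (\<forall>x\<in>edge_segment a b. \<forall>y\<in>edge_segment a b.
        set (shortest_path I x y) \<subseteq> edge_segment a b)) \<and>
     (\<forall>U\<in>routes I. \<forall>x\<in>points I.
        is_arg_min (refuel_cost I U x) (\<lambda>j. j < length (stops U)) (last_stop I U x)) \<and>
     (\<forall>U\<in>routes I. \<forall>x\<in>points I.
        deviation_index I U x \<in> subroute_indices U (start_index I U x) (return_index I U x) \<and>
        walk U ! deviation_index I U x = deviation_vertex I U x)"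

definition is_problem :: "'v::finite problem \<Rightarrow> bool" where
  "is_problem I \<longleftrightarrow>
     is_network I \<and> driving_range I > 0 \<and> max_deviation I \<ge> 0 \<and>
     finite (routes I) \<and> routes I \<noteq> {} \<and> (\<forall>U\<in>routes I. is_route I U) \<and>
     admissible_choices I"

definition remaining_length :: "'v::finite problem \<Rightarrow> 'v route \<Rightarrow> 'v point \<Rightarrow> real" where
  "remaining_length I U x =
     (if return_vertex I U x = deviation_vertex I U x then route_length I U
      else travel_length I U (vertex_position I U (return_index I U x))
                             (vertex_position I U (deviation_index I U x)))"


subsection \<open>Refueling sets and endpoints\<close>

text \<open>In the following, \<open>q\<close> and \<open>w\<close> are the two ends of an edge not traversed by \<open>U\<close>.\<close>

definition beta :: "'v::finite problem \<Rightarrow> 'v route \<Rightarrow> 'v \<Rightarrow> 'v \<Rightarrow> real" where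
  "beta I U q w =
     (let x = vertex q; d = vertex (deviation_vertex I U x); r = vertex (return_vertex I U x)
      in if driving_range I - (net_dist I d x + net_dist I (vertex w) r + remaining_length I U x)
            \<ge> net_dist I (vertex q) (vertex w)
         then net_dist I (vertex q) (vertex w)
         else (driving_range I - (net_dist I d x + net_dist I x r + remaining_length I U x)) / 2)"

definition delta :: "'v::finite problem \<Rightarrow> 'v route \<Rightarrow> 'v \<Rightarrow> 'v \<Rightarrow> real" where
  "delta I U q w =
     min (max_deviation I - net_dist I (vertex (deviation_vertex I U (vertex q))) (vertex q)) (beta I U q w)"

definition RS_from :: "'v::finite problem \<Rightarrow> 'v route \<Rightarrow> 'v \<Rightarrow> 'v \<Rightarrow> 'v point set" where
  "RS_from I U q w = {x \<in> edge_segment q w. net_dist I (vertex q) x \<le> delta I U q w}"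

definition RS :: "'v::finite problem \<Rightarrow> 'v route \<Rightarrow> 'v \<Rightarrow> 'v \<Rightarrow> 'v point set" where
  "RS I U a b =
     (if {a, b} \<in> route_edges U then edge_segment a b else RS_from I U a b \<union> RS_from I U b a)"

definition EP_on :: "'v::finite problem \<Rightarrow> 'v route \<Rightarrow> 'v \<Rightarrow> 'v \<Rightarrow> 'v point set" where
  "EP_on I U a b = \<Union>{{c, d} | c d. closed_segment c d \<in> components (RS I U a b)}"

definition EP :: "'v::finite problem \<Rightarrow> 'v point set" where
  "EP I = \<Union>{EP_on I U a b | U a b. U \<in> routes I \<and> {a, b} \<in> edges I}"


subsection \<open>Coverage and optimal solutions\<close>

definition covered_routes :: "'v::finite problem \<Rightarrow> 'v point \<Rightarrow> 'v route set" where
  "covered_routes I x = {U \<in> routes I. \<exists>a b. {a, b} \<in> edges I \<and> x \<in> RS I U a b}"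

definition feasible :: "'v::finite problem \<Rightarrow> 'v point set \<Rightarrow> bool" where
  "feasible I X \<longleftrightarrow> finite X \<and> X \<subseteq> points I \<and> (\<Union>x\<in>X. covered_routes I x) = routes I"

definition optimal :: "'v::finite problem \<Rightarrow> 'v point set \<Rightarrow> bool" where
  "optimal I X \<longleftrightarrow> is_arg_min card (feasible I) X"

end

theory Submission
  imports Defs
begin

text \<open>
  Inside an edge \<open>(a, b)\<close> the network distance is the arc length, because shortest paths between two
  points of the edge stay in it. Each refueling set is therefore a compact subset of the edge, and
  its components are closed segments (\<open>RS_component_endpoints\<close>).

  Let \<open>x\<close> be a point that covers at least one route. If \<open>x\<close> is a vertex, it lies at an end of an edge
  whose refueling set contains it, so it is the extreme point of its component and hence already an
  endpoint (\<open>covering_vertex_in_EP\<close>). Otherwise \<open>x\<close> lies on a single edge, and every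
  route covered by \<open>x\<close> contributes a segment of this edge around \<open>x\<close>. Walking from \<open>x\<close> towards \<open>b\<close>
  up to the first end of one of these finitely many segments, one stays inside all of them, so this
  end covers everything that \<open>x\<close> covers (\<open>covering_edge_point_dominated\<close>).

  For the second claim, each point of an optimal solution is replaced by an endpoint dominating
  it. This keeps every route covered and cannot increase the cardinality.
\<close>

section \<open>Coordinates on an edge\<close>

lemma edge_segment_commute: "edge_segment a b = edge_segment b a"
  unfolding edge_segment_def by (rule closed_segment_commute)

text \<open>
  The \<open>b\<close>-coordinate serves as the parameter of the edge \<open>(a, b)\<close> throughout: it determines the
  point and runs from \<open>0\<close> at \<open>a\<close> to \<open>1\<close> at \<open>b\<close>.
\<close>

lemma edge_segmentE:
  assumes "a \<noteq> b" "x \<in> edge_segment a b"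
  shows "x = (1 - x $ b) *\<^sub>R vertex a + (x $ b) *\<^sub>R vertex b" "x $ a = 1 - x $ b"
    "0 \<le> x $ b" "x $ b \<le> 1" "\<And>i. x $ i \<noteq> 0 \<Longrightarrow> i \<in> {a, b}"
proof -
  obtain u where u: "0 \<le> u" "u \<le> 1" and x: "x = (1 - u) *\<^sub>R vertex a + u *\<^sub>R vertex b"
    using assms(2) unfolding edge_segment_def in_segment by blast
  have xi: "x $ i = (if i = a then 1 - u else if i = b then u else 0)" for i
    using assms(1) by (auto simp: x vertex_def axis_def)
  then show "x $ a = 1 - x $ b" "0 \<le> x $ b" "x $ b \<le> 1" "\<And>i. x $ i \<noteq> 0 \<Longrightarrow> i \<in> {a, b}"
    using u assms(1) by (auto split: if_splits)
  show "x = (1 - x $ b) *\<^sub>R vertex a + (x $ b) *\<^sub>R vertex b"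
    using x xi[of b] assms(1) by simp
qed

lemma edge_segment_eqI:
  assumes "a \<noteq> b" "x \<in> edge_segment a b" "y \<in> edge_segment a b" "x $ b = y $ b"
  shows "x = y"
  using edge_segmentE(1)[OF assms(1,2)] edge_segmentE(1)[OF assms(1,3)] assms(4) by simp

lemma vertex_in_edge_segment: "vertex a \<in> edge_segment a b" "vertex b \<in> edge_segment a b"
  by (simp_all add: edge_segment_def)

lemma vertex_in_edge_segmentD:
  assumes "a \<noteq> b" "vertex v \<in> edge_segment a b"
  shows "v = a \<or> v = b"
  using edge_segmentE(5)[OF assms, of v] by (simp add: vertex_def axis_def)

lemma between_in_closed_segment:
  assumes ab: "a \<noteq> b" and c: "c \<in> edge_segment a b" and d: "d \<in> edge_segment a b"
    and y: "y \<in> edge_segment a b" and le: "c $ b \<le> y $ b" "y $ b \<le> d $ b"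
  shows "y \<in> closed_segment c d"
proof -
  have "y $ b \<in> closed_segment (c $ b) (d $ b)"
    using le by (simp add: closed_segment_eq_real_ivl)
  then obtain u where u: "0 \<le> u" "u \<le> 1" "y $ b = (1 - u) * c $ b + u * d $ b"
    by (auto simp: in_segment)
  let ?z = "(1 - u) *\<^sub>R c + u *\<^sub>R d"
  have z: "?z \<in> closed_segment c d"
    using u by (auto simp: in_segment)
  then have "?z \<in> edge_segment a b"
    using c d closed_segment_subset[OF _ _ convex_closed_segment] unfolding edge_segment_def by blast
  then have "y = ?z"
    using edge_segment_eqI[OF ab y] u by simp
  then show ?thesis using z by simp
qed

text \<open>
  Two different points on an edge have different coordinates at both ends, so one of them has a
  nonzero coordinate at each end. The coordinates of a point outside the ends of its edge vanish,
  hence another edge through both points must have the same ends.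
\<close>

lemma common_edge_unique:
  assumes "a \<noteq> b" "c \<noteq> d" "x \<noteq> y"
    and x: "x \<in> edge_segment a b" "x \<in> edge_segment c d"
    and y: "y \<in> edge_segment a b" "y \<in> edge_segment c d"
  shows "{a, b} = {c, d}"
proof -
  have b: "x $ b \<noteq> y $ b"
    using edge_segment_eqI[OF assms(1) x(1) y(1)] assms(3) by blast
  then have a: "x $ a \<noteq> y $ a"
    using edge_segmentE(2)[OF assms(1) x(1)] edge_segmentE(2)[OF assms(1) y(1)] by simp
  have "x $ i \<noteq> y $ i \<Longrightarrow> i \<in> {c, d}" for i
    using edge_segmentE(5)[OF assms(2) x(2), of i] edge_segmentE(5)[OF assms(2) y(2), of i] by force
  then have "a \<in> {c, d}" "b \<in> {c, d}" using a b by blast+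
  then show ?thesis using assms(1) by blast
qed

lemma non_vertex_edge_unique:
  assumes "a \<noteq> b" "c \<noteq> d" "x \<notin> range vertex"
    and x: "x \<in> edge_segment a b" "x \<in> edge_segment c d"
  shows "{a, b} = {c, d}"
proof -
  have "x \<noteq> vertex a" "x \<noteq> vertex b" using assms(3) by blast+
  then have "x $ b \<noteq> 0" "x $ a \<noteq> 0"
    using edge_segmentE(1,2)[OF assms(1) x(1)] by force+
  then have "a \<in> {c, d}" "b \<in> {c, d}"
    using edge_segmentE(5)[OF assms(2) x(2)] by blast+
  then show ?thesis using assms(1) by blast
qed


section \<open>Distances inside an edge\<close>

lemma edge_ends_distinct:
  assumes "is_problem I" "{a, b} \<in> edges I"
  shows "a \<noteq> b"
  using assms by (force simp: is_problem_def is_network_def)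

lemma edge_segment_subset_points: "{a, b} \<in> edges I \<Longrightarrow> edge_segment a b \<subseteq> points I"
  unfolding points_def by blast

lemma step_length_on_edge:
  assumes I: "is_problem I" and e: "{a, b} \<in> edges I"
    and x: "x \<in> edge_segment a b" and y: "y \<in> edge_segment a b"
  shows "step_length I x y = edge_length I {a, b} * \<bar>x $ a - y $ a\<bar>"
  unfolding step_length_def
proof (rule the_equality)
  show "\<exists>c d. {c, d} \<in> edges I \<and> x \<in> edge_segment c d \<and> y \<in> edge_segment c d \<and>
          edge_length I {a, b} * \<bar>x $ a - y $ a\<bar> = edge_length I {c, d} * \<bar>x $ c - y $ c\<bar>"
    using e x y by blast
next
  fix r
  assume "\<exists>c d. {c, d} \<in> edges I \<and> x \<in> edge_segment c d \<and> y \<in> edge_segment c d \<and>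
            r = edge_length I {c, d} * \<bar>x $ c - y $ c\<bar>"
  then obtain c d where cd: "{c, d} \<in> edges I" "x \<in> edge_segment c d" "y \<in> edge_segment c d"
    and r: "r = edge_length I {c, d} * \<bar>x $ c - y $ c\<bar>" by blast
  note ab = edge_ends_distinct[OF I e]
  show "r = edge_length I {a, b} * \<bar>x $ a - y $ a\<bar>"
  proof (cases "x = y")
    case False
    have eq: "{a, b} = {c, d}"
      using common_edge_unique[OF ab edge_ends_distinct[OF I cd(1)] False] x y cd by blast
    have "\<bar>x $ a - y $ a\<bar> = \<bar>x $ b - y $ b\<bar>"
      using edge_segmentE(2)[OF ab x] edge_segmentE(2)[OF ab y] by simp
    moreover have "c = a \<or> c = b" using eq by blast
    ultimately show ?thesis using r eq by auto
  qed (simp add: r)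
qed

text \<open>
  A path inside an edge may go back and forth, so its steps add up to at least the
  difference of the coordinates of its two ends, by the triangle inequality on the line.
\<close>

lemma path_length_inside_edge_ge:
  assumes I: "is_problem I" and e: "{a, b} \<in> edges I"
    and ps: "ps \<noteq> []" "set ps \<subseteq> edge_segment a b"
  shows "edge_length I {a, b} * \<bar>hd ps $ a - last ps $ a\<bar> \<le> path_length I ps"
proof -
  let ?L = "edge_length I {a, b}" and ?n = "length ps - 1"
  have L: "?L \<ge> 0"
    using I e by (force simp: is_problem_def is_network_def)
  have "(\<Sum>i<?n. ps ! Suc i $ a - ps ! i $ a) = ps ! ?n $ a - ps ! 0 $ a"
    by (rule sum_lessThan_telescope)
  then have "\<bar>hd ps $ a - last ps $ a\<bar> = \<bar>\<Sum>i<?n. ps ! Suc i $ a - ps ! i $ a\<bar>"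
    using ps(1) by (simp add: hd_conv_nth last_conv_nth abs_minus_commute)
  also have "\<dots> \<le> (\<Sum>i<?n. \<bar>ps ! i $ a - ps ! Suc i $ a\<bar>)"
    by (subst abs_minus_commute) (rule sum_abs)
  finally have "?L * \<bar>hd ps $ a - last ps $ a\<bar> \<le> ?L * (\<Sum>i<?n. \<bar>ps ! i $ a - ps ! Suc i $ a\<bar>)"
    using L by (rule mult_left_mono)
  also have "\<dots> = (\<Sum>i<?n. step_length I (ps ! i) (ps ! Suc i))"
    unfolding sum_distrib_left
  proof (rule sum.cong)
    fix i assume "i \<in> {..<?n}"
    then have "ps ! i \<in> edge_segment a b" "ps ! Suc i \<in> edge_segment a b"
      using ps(2) by (auto intro!: subsetD[OF ps(2)] nth_mem)
    then show "?L * \<bar>ps ! i $ a - ps ! Suc i $ a\<bar> = step_length I (ps ! i) (ps ! Suc i)"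
      using step_length_on_edge[OF I e] by simp
  qed simp
  finally show ?thesis by (simp add: path_length_def)
qed

text \<open>
  The shortest path cannot be shorter, since it stays inside the edge; it cannot be longer, since
  going straight from \<open>x\<close> to \<open>y\<close> is also a path.
\<close>

lemma net_dist_on_edge:
  assumes I: "is_problem I" and e: "{a, b} \<in> edges I"
    and x: "x \<in> edge_segment a b" and y: "y \<in> edge_segment a b"
  shows "net_dist I x y = edge_length I {a, b} * \<bar>x $ a - y $ a\<bar>"
proof (rule antisym)
  let ?p = "shortest_path I x y"
  have adm: "admissible_choices I" using I by (simp add: is_problem_def)
  have pts: "x \<in> points I" "y \<in> points I"
    using edge_segment_subset_points[OF e] x y by blast+
  have min: "is_arg_min (path_length I) (is_path I x y) ?p"
    using adm pts by (auto simp: admissible_choices_def is_shortest_path_def)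
  then have path: "is_path I x y ?p" by (simp add: is_arg_min_def)
  have "set ?p \<subseteq> edge_segment a b"
    using adm e x y by (auto simp: admissible_choices_def)
  then show "edge_length I {a, b} * \<bar>x $ a - y $ a\<bar> \<le> net_dist I x y"
    using path_length_inside_edge_ge[OF I e, of ?p] path
    by (simp add: net_dist_def is_path_def)
  have "is_path I x y [x, y]"
    using pts e x y by (auto simp: is_path_def on_common_edge_def)
  then have "path_length I ?p \<le> path_length I [x, y]"
    using min by (auto simp: is_arg_min_def not_less)
  then show "net_dist I x y \<le> edge_length I {a, b} * \<bar>x $ a - y $ a\<bar>"
    using step_length_on_edge[OF assms] by (simp add: net_dist_def path_length_def)
qed


section \<open>Components of refueling sets\<close>

lemma RS_commute: "RS I U a b = RS I U b a"
  by (simp add: RS_def insert_commute edge_segment_commute Un_commute)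

lemma RS_subset_edge_segment: "RS I U a b \<subseteq> edge_segment a b"
  using edge_segment_commute[of a b] by (auto simp: RS_def RS_from_def)

lemma EP_on_subset_RS: "EP_on I U a b \<subseteq> RS I U a b"
  unfolding EP_on_def using in_components_subset by fastforce

lemma EP_onD: "U \<in> routes I \<Longrightarrow> {a, b} \<in> edges I \<Longrightarrow> w \<in> EP_on I U a b \<Longrightarrow> w \<in> EP I"
  unfolding EP_def by blast

lemma EP_subset_points: "EP I \<subseteq> points I"
  unfolding EP_def
  using EP_on_subset_RS RS_subset_edge_segment edge_segment_subset_points by blast

lemma compact_RS_from:
  assumes "is_problem I" "{a, b} \<in> edges I"
  shows "compact (RS_from I U a b)"
proof -
  have "RS_from I U a b =
      edge_segment a b \<inter> {x. edge_length I {a, b} * \<bar>vertex a $ a - x $ a\<bar> \<le> delta I U a b}"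
    unfolding RS_from_def
    using net_dist_on_edge[OF assms vertex_in_edge_segment(1)] by auto
  moreover have "closed {x. edge_length I {a, b} * \<bar>vertex a $ a - x $ a\<bar> \<le> delta I U a b}"
    by (intro closed_Collect_le continuous_intros)
  ultimately show ?thesis
    by (simp add: edge_segment_def compact_Int_closed)
qed

lemma compact_RS:
  assumes I: "is_problem I" and e: "{a, b} \<in> edges I"
  shows "compact (RS I U a b)"
  using compact_RS_from[OF I e] compact_RS_from[OF I, of b a] e
  by (auto simp: RS_def edge_segment_def insert_commute intro: compact_Un)

text \<open>
  A component of a compact subset of a line is compact, connected and collinear, hence a closed
  segment. Its ends are named in the order of their \<open>b\<close>-coordinates, so that segments belonging to
  different routes can be compared.
\<close>

lemma RS_component_endpoints:
  assumes I: "is_problem I" and e: "{a, b} \<in> edges I" and x: "x \<in> RS I U a b"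
  obtains c d where "c \<in> EP_on I U a b" "d \<in> EP_on I U a b" "c $ b \<le> x $ b" "x $ b \<le> d $ b"
    "\<And>y. y \<in> edge_segment a b \<Longrightarrow> c $ b \<le> y $ b \<Longrightarrow> y $ b \<le> d $ b \<Longrightarrow> y \<in> RS I U a b"
proof -
  let ?S = "RS I U a b"
  define K where "K = connected_component_set ?S x"
  have K: "K \<in> components ?S" and xK: "x \<in> K"
    using x by (auto simp: K_def componentsI)
  have KS: "K \<subseteq> ?S" using K by (rule in_components_subset)
  have "collinear K"
    using collinear_subset[OF collinear_closed_segment] KS RS_subset_edge_segment[of I U a b]
    unfolding edge_segment_def by (metis subset_trans)
  moreover have "convex K"
    using in_components_connected[OF K] convex_connected_collinear \<open>collinear K\<close> by blast
  moreover have "compact K"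
    using compact_components[OF compact_RS[OF I e] K] .
  ultimately obtain p q where pq: "K = closed_segment p q"
    using compact_convex_collinear_segment xK by blast
  obtain c d where cd: "K = closed_segment c d" "c $ b \<le> d $ b"
    using that pq closed_segment_commute[of p q] by (metis linear)
  have "closed_segment c d \<in> components ?S" using K cd(1) by simp
  then have ep: "c \<in> EP_on I U a b" "d \<in> EP_on I U a b" unfolding EP_on_def by blast+
  have "x $ b \<in> (\<lambda>x. x $ b) ` closed_segment c d" using xK cd(1) by blast
  also have "\<dots> = {c $ b .. d $ b}"
    using closed_segment_linear_image[OF bounded_linear.linear[OF bounded_linear_vec_nth[of b]], of c d]
      closed_segment_eq_real_ivl1[OF cd(2)] by simp
  finally have "c $ b \<le> x $ b" "x $ b \<le> d $ b" by auto
  moreover have "y \<in> ?S" if "y \<in> edge_segment a b" "c $ b \<le> y $ b" "y $ b \<le> d $ b" for y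
    using between_in_closed_segment[OF edge_ends_distinct[OF I e], of c d y] that ep
      EP_on_subset_RS[of I U a b] RS_subset_edge_segment[of I U a b] KS cd(1) by blast
  ultimately show thesis using that ep by blast
qed


section \<open>Endpoints dominate all points\<close>

lemma covering_vertex_in_EP:
  assumes I: "is_problem I" and U: "U \<in> covered_routes I (vertex v)"
  shows "vertex v \<in> EP I"
proof -
  obtain a b where e: "{a, b} \<in> edges I" and r: "vertex v \<in> RS I U a b"
    using U by (auto simp: covered_routes_def)
  have "v = a \<or> v = b"
    using vertex_in_edge_segmentD[OF edge_ends_distinct[OF I e]] r
      RS_subset_edge_segment[of I U a b] by blast
  then obtain u where u: "{u, v} \<in> edges I" "vertex v \<in> RS I U u v"
    using e r RS_commute[of I U a b] by (metis insert_commute)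
  note uv = edge_ends_distinct[OF I u(1)]
  obtain d where d: "d \<in> EP_on I U u v" "vertex v $ v \<le> d $ v"
    using RS_component_endpoints[OF I u] by metis
  have dE: "d \<in> edge_segment u v"
    using d(1) EP_on_subset_RS RS_subset_edge_segment by blast
  \<comment> \<open>The \<open>v\<close>-coordinate is largest at \<open>v\<close>, so the segment around \<open>v\<close> ends there.\<close>
  have "d $ v = vertex v $ v"
    using d(2) edge_segmentE(4)[OF uv dE] by (simp add: vertex_def)
  then have "d = vertex v"
    using edge_segment_eqI[OF uv dE vertex_in_edge_segment(2)] by blast
  then show ?thesis
    using EP_onD[OF _ u(1) d(1)] U by (simp add: covered_routes_def)
qed

lemma covering_edge_point_dominated:
  assumes I: "is_problem I" and e: "{a, b} \<in> edges I" and x: "x \<in> edge_segment a b"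
    and nv: "x \<notin> range vertex" and ne: "covered_routes I x \<noteq> {}"
  shows "\<exists>w\<in>EP I. covered_routes I x \<subseteq> covered_routes I w"
proof -
  let ?T = "covered_routes I x"
  note ab = edge_ends_distinct[OF I e]
  have inRS: "x \<in> RS I U a b" if U: "U \<in> ?T" for U
  proof -
    obtain c d where cd: "{c, d} \<in> edges I" "x \<in> RS I U c d"
      using U by (auto simp: covered_routes_def)
    then have "{a, b} = {c, d}"
      using non_vertex_edge_unique[OF ab edge_ends_distinct[OF I cd(1)] nv x]
        RS_subset_edge_segment by blast
    then show ?thesis using cd(2) RS_commute by (metis doubleton_eq_iff)
  qed
  have "\<exists>d. d \<in> EP_on I U a b \<and> x $ b \<le> d $ b \<and>
      (\<forall>y\<in>edge_segment a b. x $ b \<le> y $ b \<longrightarrow> y $ b \<le> d $ b \<longrightarrow> y \<in> RS I U a b)"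
    if U: "U \<in> ?T" for U
  proof -
    obtain c d where "d \<in> EP_on I U a b" "c $ b \<le> x $ b" "x $ b \<le> d $ b"
      "\<And>y. y \<in> edge_segment a b \<Longrightarrow> c $ b \<le> y $ b \<Longrightarrow> y $ b \<le> d $ b \<Longrightarrow> y \<in> RS I U a b"
      using RS_component_endpoints[OF I e inRS[OF U]] by blast
    then show ?thesis using order_trans[of "c $ b" "x $ b"] by blast
  qed
  then obtain D where D: "\<And>U. U \<in> ?T \<Longrightarrow> D U \<in> EP_on I U a b"
      "\<And>U. U \<in> ?T \<Longrightarrow> x $ b \<le> D U $ b"
      "\<And>U y. U \<in> ?T \<Longrightarrow> y \<in> edge_segment a b \<Longrightarrow> x $ b \<le> y $ b \<Longrightarrow> y $ b \<le> D U $ b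
          \<Longrightarrow> y \<in> RS I U a b"
    by metis
  have fin: "finite ?T"
    using I by (auto simp: covered_routes_def is_problem_def)
  define U0 where "U0 = arg_min_on (\<lambda>U. D U $ b) ?T"
  have U0: "U0 \<in> ?T" and least: "\<And>U. U \<in> ?T \<Longrightarrow> D U0 $ b \<le> D U $ b"
    using arg_min_if_finite[OF fin ne, of "\<lambda>U. D U $ b"] unfolding U0_def
    by (auto simp: not_less)
  have "D U0 \<in> edge_segment a b"
    using D(1)[OF U0] EP_on_subset_RS RS_subset_edge_segment by blast
  then have "D U0 \<in> RS I U a b" if "U \<in> ?T" for U
    using D(2)[OF U0] D(3)[OF that] least[OF that] by blast
  then have "?T \<subseteq> covered_routes I (D U0)"
    using e unfolding covered_routes_def by blast
  moreover have "D U0 \<in> EP I"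
    using EP_onD[OF _ e D(1)[OF U0]] U0 by (simp add: covered_routes_def)
  ultimately show ?thesis by blast
qed

lemma route_covered_by_vertex:
  assumes I: "is_problem I" and U: "U \<in> routes I"
  shows "\<exists>v. U \<in> covered_routes I (vertex v)"
proof -
  have r: "is_route I U" using I U by (simp add: is_problem_def)
  let ?a = "walk U ! 0" and ?b = "walk U ! Suc 0"
  have "length (walk U) \<ge> 2" using r unfolding is_route_def by blast
  then have "0 < num_steps U" by linarith
  then have re: "{?a, ?b} \<in> route_edges U"
    unfolding route_edges_def by blast
  then have "{?a, ?b} \<in> edges I" using r unfolding is_route_def by blast
  moreover have "vertex ?a \<in> RS I U ?a ?b"
    using re by (simp add: RS_def vertex_in_edge_segment)
  ultimately show ?thesis using U by (auto simp: covered_routes_def)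
qed

lemma point_dominated_by_endpoint:
  assumes I: "is_problem I" and x: "x \<in> points I"
  shows "\<exists>w\<in>EP I. covered_routes I x \<subseteq> covered_routes I w"
proof (cases "covered_routes I x = {}")
  case True
  \<comment> \<open>Any endpoint will do; some vertex covers a route and is therefore one.\<close>
  obtain U where "U \<in> routes I" using I by (auto simp: is_problem_def)
  then obtain v where "vertex v \<in> EP I"
    using route_covered_by_vertex[OF I] covering_vertex_in_EP[OF I] by blast
  then show ?thesis using True by blast
next
  case False
  show ?thesis
  proof (cases "x \<in> range vertex")
    case True
    then show ?thesis using covering_vertex_in_EP[OF I] False by blast
  next
    case nv: False
    then obtain a b where "{a, b} \<in> edges I" "x \<in> edge_segment a b"
      using x by (auto simp: points_def)
    then show ?thesis using covering_edge_point_dominated[OF I _ _ nv False] by blast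
  qed
qed


section \<open>Optimal solutions among the endpoints\<close>

text \<open>
  The finite set of all vertices is feasible, because each route traverses an edge and is covered by
  its ends. So there is a feasible set of least cardinality.
\<close>

lemma optimal_exists:
  assumes I: "is_problem I"
  shows "\<exists>X. optimal I X"
proof -
  have "feasible I (range vertex)"
    using route_covered_by_vertex[OF I]
    by (fastforce simp: feasible_def points_def covered_routes_def)
  then show ?thesis
    unfolding optimal_def by (intro exI) (rule is_arg_min_arg_min_nat)
qed

theorem theorem1:
  fixes I :: "'v::finite problem"
  assumes "is_problem I"
  shows "(\<forall>x\<in>points I. \<exists>w\<in>EP I. covered_routes I x \<subseteq> covered_routes I w) \<and>
         (\<exists>X. optimal I X \<and> X \<subseteq> EP I)"
proof
  show dom: "\<forall>x\<in>points I. \<exists>w\<in>EP I. covered_routes I x \<subseteq> covered_routes I w"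
    using point_dominated_by_endpoint[OF assms] by blast
  then obtain W where W: "\<And>x. x \<in> points I \<Longrightarrow> W x \<in> EP I"
      "\<And>x. x \<in> points I \<Longrightarrow> covered_routes I x \<subseteq> covered_routes I (W x)"
    by metis
  obtain X where X: "optimal I X" using optimal_exists[OF assms] by blast
  then have feas: "feasible I X" and least: "\<And>Y. feasible I Y \<Longrightarrow> card X \<le> card Y"
    by (auto simp: optimal_def is_arg_min_def not_less)
  have fin: "finite X" and pts: "X \<subseteq> points I"
    and cov: "(\<Union>x\<in>X. covered_routes I x) = routes I"
    using feas by (auto simp: feasible_def)
  have sub: "W ` X \<subseteq> EP I" using W(1) pts by blast
  have "(\<Union>x\<in>X. covered_routes I x) \<subseteq> (\<Union>x\<in>X. covered_routes I (W x))"
    by (rule UN_mono[OF subset_refl]) (rule W(2)[OF subsetD[OF pts]])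
  then have "routes I \<subseteq> (\<Union>w\<in>W ` X. covered_routes I w)"
    by (simp add: cov)
  moreover have "(\<Union>w\<in>W ` X. covered_routes I w) \<subseteq> routes I"
    by (auto simp: covered_routes_def)
  ultimately have "feasible I (W ` X)"
    using fin sub EP_subset_points[of I] by (auto simp: feasible_def)
  moreover have "card (W ` X) \<le> card Y" if "feasible I Y" for Y
    using card_image_le[OF fin, of W] least[OF that] by simp
  ultimately have "optimal I (W ` X)"
    by (auto simp: optimal_def is_arg_min_def not_less)
  then show "\<exists>X. optimal I X \<and> X \<subseteq> EP I" using sub by blast
qed

end
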